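(* Let $n$ and $r$ be integers with $n\ge r+1$ and $r\ge 1$. Then $$\mathrm{CC}(n,r)\le 2\,\mathrm{C}(n,r)-1 .$$
   Context: For integers $n\ge r+1$, $r\ge 1$, an $(n,r+1,r)$-covering is a family $\mathcal{B}$ of $(r+1)$-subsets of $\{1,\ldots,n\}$, called blocks, such that each $r$-subset of $\{1,\ldots,n\}$ is contained in at least one block. Its size is the number of blocks. The graph $G(\mathcal{B})$ has the blocks as vertices, and two distinct blocks are adjacent if they have an $r$-subset in common (i.e. their intersection has exactly $r$ elements). The covering is connected if $G(\mathcal{B})$ is connected. $\mathrm{C}(n,r)$ denotes the minimum size of an $(n,r+1,r)$-covering, and $\mathrm{CC}(n,r)$ denotes the minimum size of a connected $(n,r+1,r)$-covering. *)

theory Defs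
  imports Main "Graph_Theory.Digraph_Component"
begin

definition is_covering :: "nat \<Rightarrow> nat \<Rightarrow> nat set set \<Rightarrow> bool" where
  "is_covering n r \<B> \<longleftrightarrow>
     (\<forall>A\<in>\<B>. A \<subseteq> {1..n} \<and> card A = r + 1) \<and>
     (\<forall>S. S \<subseteq> {1..n} \<and> card S = r \<longrightarrow> (\<exists>A\<in>\<B>. S \<subseteq> A))"

text \<open>The simple graph on the blocks is encoded as the digraph containing both orientations of
  each edge; on such digraphs \<^const>\<open>Digraph_Component.connected\<close> is ordinary graph
  connectedness (which includes nonemptiness of the vertex set).\<close>

definition block_graph :: "nat \<Rightarrow> nat set set \<Rightarrow> nat set pair_pre_digraph" where
  "block_graph r \<B> =
     \<lparr> pverts = \<B>, parcs = {(A, B). A \<in> \<B> \<and> B \<in> \<B> \<and> A \<noteq> B \<and> card (A \<inter> B) = r} \<rparr>"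

definition is_connected_covering :: "nat \<Rightarrow> nat \<Rightarrow> nat set set \<Rightarrow> bool" where
  "is_connected_covering n r \<B> \<longleftrightarrow>
     is_covering n r \<B> \<and> Digraph_Component.connected (with_proj (block_graph r \<B>))"

text \<open>The two minima below are attained whenever \<open>r + 1 \<le> n\<close>: the family of all
  \<open>(r + 1)\<close>-subsets is a connected covering (lemma \<open>all_blocks_connected_covering\<close>).\<close>

definition covering_number :: "nat \<Rightarrow> nat \<Rightarrow> nat" where
  "covering_number n r = (LEAST m. \<exists>\<B>. is_covering n r \<B> \<and> card \<B> = m)"

definition connected_covering_number :: "nat \<Rightarrow> nat \<Rightarrow> nat" where
  "connected_covering_number n r = (LEAST m. \<exists>\<B>. is_connected_covering n r \<B> \<and> card \<B> = m)"

lemma finite_covering: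
  assumes "is_covering n r \<B>"
  shows "finite \<B>"
proof (rule finite_subset)
  show "\<B> \<subseteq> Pow {1..n}" using assms by (auto simp: is_covering_def)
qed simp

lemma connected_block_graph_iff:
  "Digraph_Component.connected (with_proj (block_graph r \<B>)) \<longleftrightarrow>
     \<B> \<noteq> {} \<and> (\<forall>A\<in>\<B>. \<forall>B\<in>\<B>.
       (A, B) \<in> rtrancl_on \<B> {(A, B). A \<in> \<B> \<and> B \<in> \<B> \<and> A \<noteq> B \<and> card (A \<inter> B) = r})"
proof -
  have "parcs (mk_symmetric (with_proj (block_graph r \<B>))) = parcs (block_graph r \<B>)"
    unfolding mk_symmetric_def by (auto simp: block_graph_def Int_commute)
  moreover have "pverts (mk_symmetric (with_proj (block_graph r \<B>))) = \<B>"
    unfolding mk_symmetric_def by (simp add: block_graph_def)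
  ultimately show ?thesis
    by (simp add: Digraph_Component.connected_def strongly_connected_def reachable_def
        block_graph_def)
qed

lemma all_blocks_connected_covering:
  assumes "r + 1 \<le> n"
  shows "is_connected_covering n r {A. A \<subseteq> {1..n} \<and> card A = r + 1}"
proof -
  define F where "F = {A. A \<subseteq> {1..n} \<and> card A = r + 1}"
  define E where "E = {(A, B). A \<in> F \<and> B \<in> F \<and> A \<noteq> B \<and> card (A \<inter> B) = r}"
  have "\<exists>A\<in>F. S \<subseteq> A" if "S \<subseteq> {1..n}" "card S = r" for S
  proof -
    have "\<not> {1..n} \<subseteq> S"
      using that assms card_mono[of S "{1..n}"] finite_subset[of S "{1..n}"] by auto
    then obtain x where "x \<in> {1..n}" "x \<notin> S" by blast
    then have "insert x S \<in> F"
      using that finite_subset[of S "{1..n}"] by (auto simp: F_def)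
    then show ?thesis by blast
  qed
  then have cov: "is_covering n r F"
    by (auto simp: is_covering_def F_def)
  have "{1..r + 1} \<in> F" using assms by (auto simp: F_def)
  then have ne: "F \<noteq> {}" by blast
  have "(A, B) \<in> rtrancl_on F E" if "A \<in> F" "B \<in> F" for A B
    using that
  proof (induction "card (A - B)" arbitrary: A)
    case 0
    have "finite A" "finite B" "card A = card B"
      using 0 finite_subset[of _ "{1..n}"] by (auto simp: F_def)
    moreover have "A \<subseteq> B" using 0 \<open>finite A\<close> by simp
    ultimately have "A = B" by (simp add: card_subset_eq)
    then show ?case using 0 by simp
  next
    case (Suc k)
    have fin: "finite A" "finite B" and cards: "card A = r + 1" "card B = r + 1"
      using Suc.prems finite_subset[of _ "{1..n}"] by (auto simp: F_def)
    obtain a where a: "a \<in> A" "a \<notin> B"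
      using Suc.hyps(2) by (metis Diff_iff card_eq_SucD insertI1)
    have "\<not> B \<subseteq> A" using card_subset_eq[of A B] fin cards a by auto
    then obtain b where b: "b \<in> B" "b \<notin> A" by blast
    let ?A' = "insert b (A - {a})"
    have mem: "?A' \<in> F"
      using Suc.prems a b fin cards by (auto simp: F_def)
    have "?A' - B = (A - B) - {a}" using a b by auto
    then have "k = card (?A' - B)" using Suc.hyps(2) a fin by simp
    then have rest: "(?A', B) \<in> rtrancl_on F E"
      using Suc.hyps(1) mem Suc.prems by blast
    have "A \<inter> ?A' = A - {a}" using b by auto
    then have "(A, ?A') \<in> E"
      using mem Suc.prems a b fin cards by (auto simp: E_def)
    then show ?case
      using rest Suc.prems by (meson converse_rtrancl_on_into_rtrancl_on)
  qed
  then show ?thesis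
    using cov ne unfolding is_connected_covering_def connected_block_graph_iff F_def E_def
    by blast
qed

end

theory Submission
  imports Defs
begin

text \<open>Let \<open>\<B>\<close> be a covering and grow a connected family \<open>K\<close>, starting from a single block of
  \<open>\<B>\<close>. As long as \<open>K\<close> misses a block of \<open>\<B>\<close>, one \<open>(r + 1)\<close>-set \<open>X\<close> links \<open>K\<close> to some
  block \<open>B \<in> \<B> - K\<close> (lemma \<open>bridge\<close>), so adding \<open>X\<close> and \<open>B\<close> keeps \<open>K\<close> connected. Every round
  costs at most two sets and gains a block of \<open>\<B>\<close>. Hence all of \<open>\<B>\<close> is absorbed by a connected
  family of at most \<open>2 * card \<B> - 1\<close> sets, and any family of \<open>(r + 1)\<close>-sets containing a
  covering is a covering.

  The bridge exists because the graph on all \<open>(r + 1)\<close>-subsets of \<open>{1..n}\<close> is connected.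
  Walk in it from \<open>K\<close> to \<open>\<B> - K\<close>. The \<open>r\<close>-set shared by two consecutive vertices
  \<open>X\<close>, \<open>Y\<close> lies in a block of \<open>\<B>\<close>, which is near both. If it is outside \<open>K\<close> and \<open>X\<close> is near
  \<open>K\<close>, then \<open>X\<close> is a bridge; otherwise \<open>Y\<close> is near \<open>K\<close> as well. A walk without a bridge would
  therefore stay near \<open>K\<close> up to its last vertex, which would then be a bridge itself.\<close>

definition blocks :: "nat \<Rightarrow> nat \<Rightarrow> nat set set" where
  "blocks n r = {A. A \<subseteq> {1..n} \<and> card A = r + 1}"

definition adj :: "nat \<Rightarrow> nat set set \<Rightarrow> (nat set \<times> nat set) set" where
  "adj r \<B> = {(A, B). A \<in> \<B> \<and> B \<in> \<B> \<and> A \<noteq> B \<and> card (A \<inter> B) = r}"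

text \<open>On \<open>(r + 1)\<close>-sets this is the reflexive closure of adjacency. Adding a set near a connected
  family then keeps it connected also when the set is already a member.\<close>

definition near :: "nat \<Rightarrow> nat set \<Rightarrow> nat set \<Rightarrow> bool" where
  "near r A B \<longleftrightarrow> A = B \<or> card (A \<inter> B) = r"

lemma near_sym: "near r A B \<longleftrightarrow> near r B A"
  by (auto simp: near_def Int_commute)

lemma finite_blocks: "finite (blocks n r)"
  by (rule finite_subset[of _ "Pow {1..n}"]) (auto simp: blocks_def)

text \<open>Edges of \<open>adj r K\<close> stay inside \<open>K\<close>, so the ordinary closure, with its richer calculus, may
  replace the closure relative to \<open>K\<close>.\<close>

lemma connected_iff_rtrancl:
  "Digraph_Component.connected (with_proj (block_graph r K)) \<longleftrightarrow>
     K \<noteq> {} \<and> (\<forall>A\<in>K. \<forall>B\<in>K. (A, B) \<in> (adj r K)\<^sup>*)"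
proof -
  have "(A, B) \<in> (adj r K)\<^sup>* \<longleftrightarrow> (A, B) \<in> rtrancl_on K (adj r K)" if "A \<in> K" for A B
  proof
    assume "(A, B) \<in> (adj r K)\<^sup>*"
    then show "(A, B) \<in> rtrancl_on K (adj r K)"
    proof (induction rule: rtrancl_induct)
      case base
      show ?case using that by simp
    next
      case (step Y Z)
      then show ?case
        by (auto simp: adj_def intro: rtrancl_on_into_rtrancl_on)
    qed
  next
    assume "(A, B) \<in> rtrancl_on K (adj r K)"
    then show "(A, B) \<in> (adj r K)\<^sup>*"
      by (rule rtrancl_on_rtranclI)
  qed
  then show ?thesis
    by (auto simp: connected_block_graph_iff adj_def[symmetric])
qed

lemma connected_insert_near:
  assumes conn: "Digraph_Component.connected (with_proj (block_graph r K))"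
    and A: "A \<in> K" and X: "near r A X"
  shows "Digraph_Component.connected (with_proj (block_graph r (insert X K)))"
proof -
  let ?R = "(adj r (insert X K))\<^sup>*"
  have mono: "(adj r K)\<^sup>* \<subseteq> ?R"
    by (rule rtrancl_mono) (auto simp: adj_def)
  have in_K: "(B, C) \<in> ?R" if "B \<in> K" "C \<in> K" for B C
    using conn that mono by (auto simp: connected_iff_rtrancl)
  have "A = X \<or> (A, X) \<in> adj r (insert X K) \<and> (X, A) \<in> adj r (insert X K)"
    using A X by (auto simp: near_def adj_def Int_commute)
  then have "(A, X) \<in> ?R" "(X, A) \<in> ?R" by auto
  then have "(B, C) \<in> ?R" if "B \<in> insert X K" "C \<in> insert X K" for B C
    using that in_K A by (metis insertE rtrancl_trans rtrancl.rtrancl_refl)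
  then show ?thesis by (auto simp: connected_iff_rtrancl)
qed

lemma subset_both_imp_near:
  assumes "X \<in> blocks n r" "Y \<in> blocks n r" "card S = r" "S \<subseteq> X" "S \<subseteq> Y"
  shows "near r X Y"
proof (cases "X = Y")
  case False
  have fin: "finite X" "finite Y" and cards: "card X = r + 1" "card Y = r + 1"
    using assms finite_subset[of _ "{1..n}"] by (auto simp: blocks_def)
  have "\<not> X \<subseteq> Y" using False fin cards card_subset_eq[of Y X] by auto
  then have "X \<inter> Y \<subset> X" by auto
  then have "card (X \<inter> Y) < r + 1"
    using fin cards psubset_card_mono by metis
  moreover have "r \<le> card (X \<inter> Y)"
    using assms fin card_mono[of "X \<inter> Y" S] by auto
  ultimately show ?thesis by (simp add: near_def)
qed (simp add: near_def)

lemma bridge: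
  assumes n: "r + 1 \<le> n" and cov: "is_covering n r \<B>"
    and K: "K \<subseteq> blocks n r" "K \<noteq> {}" and rest: "\<not> \<B> \<subseteq> K"
  obtains A X B where "A \<in> K" "B \<in> \<B> - K" "X \<in> blocks n r" "near r A X" "near r X B"
proof -
  have \<B>: "\<B> \<subseteq> blocks n r" using cov by (auto simp: is_covering_def blocks_def)
  obtain A B where A: "A \<in> K" and B: "B \<in> \<B> - K" using K rest by auto
  have "(A, B) \<in> (adj r (blocks n r))\<^sup>*"
    using all_blocks_connected_covering[OF n] A B K \<B>
    unfolding is_connected_covering_def connected_iff_rtrancl blocks_def by blast
  then have "(\<exists>C\<in>K. near r C B) \<or>
    (\<exists>A\<in>K. \<exists>B\<in>\<B> - K. \<exists>X\<in>blocks n r. near r A X \<and> near r X B)"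
  proof (induction rule: rtrancl_induct)
    case base
    show ?case using A by (auto simp: near_def)
  next
    case (step X Y)
    then have XY: "X \<in> blocks n r" "Y \<in> blocks n r" "card (X \<inter> Y) = r" "X \<inter> Y \<subseteq> {1..n}"
      by (auto simp: adj_def blocks_def)
    then obtain D where D: "D \<in> \<B>" "X \<inter> Y \<subseteq> D"
      using cov unfolding is_covering_def by blast
    have "near r X D" "near r D Y"
      using subset_both_imp_near[OF _ _ XY(3)] XY D \<B> by auto
    then show ?case
      using step.IH XY D by blast
  qed
  moreover have "near r B B" by (simp add: near_def)
  ultimately show ?thesis using that B \<B> by blast
qed

text \<open>The bound \<open>card K < 2 * card (K \<inter> \<B>)\<close> is the invariant of the growth: a single block of
  \<open>\<B>\<close> satisfies it, and a round adds at most two to the left and at least two to the right.\<close>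

lemma absorb_covering:
  assumes n: "r + 1 \<le> n" and cov: "is_covering n r \<B>"
    and "K \<subseteq> blocks n r" "Digraph_Component.connected (with_proj (block_graph r K))"
    and "card K < 2 * card (K \<inter> \<B>)"
  shows "\<exists>L. \<B> \<subseteq> L \<and> L \<subseteq> blocks n r \<and>
    Digraph_Component.connected (with_proj (block_graph r L)) \<and> card L < 2 * card \<B>"
  using assms(3-)
proof (induction "card (\<B> - K)" arbitrary: K rule: less_induct)
  case less
  have fin: "finite K" "finite \<B>"
    using less.prems finite_blocks finite_subset finite_covering[OF cov] by blast+
  show ?case
  proof (cases "\<B> \<subseteq> K")
    case True
    then show ?thesis using less.prems by (auto simp: Int_absorb1)
  next
    case False
    have "K \<noteq> {}" using less.prems by (simp add: connected_iff_rtrancl)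
    then obtain A X B where br: "A \<in> K" "B \<in> \<B> - K" "X \<in> blocks n r" "near r A X" "near r X B"
      using bridge[OF n cov less.prems(1) _ False] by blast
    let ?K = "insert B (insert X K)"
    have "Digraph_Component.connected (with_proj (block_graph r ?K))"
      using less.prems br by (meson connected_insert_near insertI1)
    moreover have "?K \<subseteq> blocks n r"
      using less.prems br cov by (auto simp: is_covering_def blocks_def)
    moreover have "card ?K < 2 * card (?K \<inter> \<B>)"
    proof -
      have "card ?K \<le> card K + 2"
        using fin by (auto simp: card_insert_if)
      moreover have "card (insert B (K \<inter> \<B>)) \<le> card (?K \<inter> \<B>)"
        using fin br by (intro card_mono) auto
      moreover have "card (insert B (K \<inter> \<B>)) = card (K \<inter> \<B>) + 1"
        using fin br by simp
      ultimately show ?thesis using less.prems(3) by linarith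
    qed
    moreover have "card (\<B> - ?K) < card (\<B> - K)"
      using fin br by (intro psubset_card_mono) auto
    ultimately show ?thesis using less.hyps by blast
  qed
qed

theorem mainTheorem7:
  fixes n r :: nat
  assumes "n \<ge> r + 1" and "r \<ge> 1"
  shows "int (connected_covering_number n r) \<le> 2 * int (covering_number n r) - 1"
proof -
  have "\<exists>m \<B>. is_covering n r \<B> \<and> card \<B> = m"
    using all_blocks_connected_covering assms by (auto simp: is_connected_covering_def)
  then have "\<exists>\<B>. is_covering n r \<B> \<and> card \<B> = covering_number n r"
    unfolding covering_number_def by (rule LeastI_ex)
  then obtain \<B> where cov: "is_covering n r \<B>" and card: "card \<B> = covering_number n r"
    by blast
  have "{1..r} \<subseteq> {1..n} \<and> card {1..r} = r" using assms by auto
  then obtain A where A: "A \<in> \<B>" using cov unfolding is_covering_def by blast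
  have "{A} \<subseteq> blocks n r" using A cov by (auto simp: is_covering_def blocks_def)
  moreover have "Digraph_Component.connected (with_proj (block_graph r {A}))"
    by (simp add: connected_iff_rtrancl)
  moreover have "card {A} < 2 * card ({A} \<inter> \<B>)" using A by simp
  ultimately obtain L where L: "\<B> \<subseteq> L" "L \<subseteq> blocks n r"
      "Digraph_Component.connected (with_proj (block_graph r L))" "card L < 2 * card \<B>"
    using absorb_covering[OF _ cov, of "{A}"] assms by blast
  have "\<exists>B\<in>L. S \<subseteq> B" if S: "S \<subseteq> {1..n}" "card S = r" for S
  proof -
    obtain B where "B \<in> \<B>" "S \<subseteq> B" using cov S unfolding is_covering_def by blast
    then show ?thesis using L(1) by blast
  qed
  moreover have "A \<subseteq> {1..n} \<and> card A = r + 1" if "A \<in> L" for A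
    using L(2) that by (auto simp: blocks_def)
  ultimately have "is_covering n r L"
    unfolding is_covering_def by (intro conjI ballI allI impI) simp_all
  then have "is_connected_covering n r L"
    using L(3) by (simp add: is_connected_covering_def)
  then have "connected_covering_number n r \<le> card L"
    unfolding connected_covering_number_def by (intro Least_le) blast
  then show ?thesis using L(4) card by linarith
qed

end
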